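(* Fix $\lambda\in[0,1)$ and $p\in[0,1]$. For every $\mathbf{v}^0\in\overline{\mathcal{V}}^\infty$, letting $\mathbf{v}(\mathbf{v}^0,t)$ be the unique solution to the fluid model with initial condition $\mathbf{v}^0$, we have $\lim_{t\to\infty}\|\mathbf{v}(\mathbf{v}^0,t)-\mathbf{v}^I\|_w=0$, where $\mathbf{v}^I$ is the unique element of $\overline{\mathcal{V}}^\infty$ satisfying $\lambda(\mathbf{v}^I_{i-1}-\mathbf{v}^I_i)-(1-p)(\mathbf{v}^I_i-\mathbf{v}^I_{i+1})-g_i(\mathbf{v}^I)=0$ for all $i\ge1$.
   Context: $\mathbb{Z}_+=\{0,1,2,\dots\}$. $\mathcal{S}=\{\mathbf{s}\in[0,1]^{\mathbb{Z}_+}:1=\mathbf{s}_0\ge\mathbf{s}_1\ge\cdots\ge0\}$, $\overline{\mathcal{S}}^\infty=\{\mathbf{s}\in\mathcal{S}:\sum_{i\ge1}\mathbf{s}_i<\infty\}$, $\overline{\mathcal{V}}^\infty=\{\mathbf{v}:\mathbf{v}_i=\sum_{j\ge i}\mathbf{s}_j\ \forall i,\ \text{for some }\mathbf{s}\in\overline{\mathcal{S}}^\infty\}$. Weighted norm: $\|\mathbf{x}\|_w^2=\sum_{i\ge0}2^{-i}\mathbf{x}_i^2$. For $\mathbf{v}\in\overline{\mathcal{V}}^\infty$, $i\ge1$: $g_i(\mathbf{v})=p$ if $\mathbf{v}_i>0$, $=\min\{\lambda\mathbf{v}_{i-1},p\}$ if $\mathbf{v}_i=0<\mathbf{v}_{i-1}$,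 $=0$ if $\mathbf{v}_i=\mathbf{v}_{i-1}=0$. A solution to the fluid model with initial condition $\mathbf{v}^0$ is $\mathbf{v}:[0,\infty)\to\overline{\mathcal{V}}^\infty$ such that: (0) all coordinates are $L$-Lipschitz for a common constant $L$; (1) $\mathbf{v}(0)=\mathbf{v}^0$; (2) for all $t$, $\mathbf{v}_0(t)-\mathbf{v}_1(t)=1$ and $1\ge\mathbf{v}_i-\mathbf{v}_{i+1}\ge\mathbf{v}_{i+1}-\mathbf{v}_{i+2}\ge0$ for all $i\ge0$; (3) for a.e. $t$, for all $i\ge1$, $\dot{\mathbf{v}}_i=\lambda(\mathbf{v}_{i-1}-\mathbf{v}_i)-(1-p)(\mathbf{v}_i-\mathbf{v}_{i+1})-g_i(\mathbf{v})$. Such a solution exists and is unique for each $\mathbf{v}^0\in\overline{\mathcal{V}}^\infty$, and $\mathbf{v}^I$ exists and is unique. *)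

theory Defs
  imports "HOL-Analysis.Analysis"
begin

definition S_bar_inf :: "(nat \<Rightarrow> real) set" where
  "S_bar_inf = {s. s 0 = 1 \<and> (\<forall>i. 0 \<le> s i \<and> s i \<le> 1 \<and> s (Suc i) \<le> s i)
                 \<and> summable (\<lambda>i. s (Suc i))}"

definition V_bar_inf :: "(nat \<Rightarrow> real) set" where
  "V_bar_inf = {v. \<exists>s\<in>S_bar_inf. \<forall>i. v i = (\<Sum>j. s (j + i))}"

definition wnorm :: "(nat \<Rightarrow> real) \<Rightarrow> real" where
  "wnorm x = sqrt (\<Sum>i. (1/2) ^ i * (x i)\<^sup>2)"

text \<open>The function g_i (meaningful for i >= 1).\<close>
definition g_fun :: "real \<Rightarrow> real \<Rightarrow> (nat \<Rightarrow> real) \<Rightarrow> nat \<Rightarrow> real" where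
  "g_fun lam p v i =
     (if v i > 0 then p
      else if v (i - 1) > 0 then min (lam * v (i - 1)) p
      else 0)"

definition fluid_solution ::
  "real \<Rightarrow> real \<Rightarrow> (nat \<Rightarrow> real) \<Rightarrow> (real \<Rightarrow> nat \<Rightarrow> real) \<Rightarrow> bool" where
  "fluid_solution lam p v0 v \<longleftrightarrow>
     (\<forall>t\<ge>0. v t \<in> V_bar_inf) \<and>
     (\<exists>L. \<forall>i. lipschitz_on L {0..} (\<lambda>t. v t i)) \<and>
     v 0 = v0 \<and>
     (\<forall>t\<ge>0. v t 0 - v t 1 = 1 \<and>
        (\<forall>i. 1 \<ge> v t i - v t (Suc i) \<and>
             v t i - v t (Suc i) \<ge> v t (Suc i) - v t (Suc (Suc i)) \<and>
             v t (Suc i) - v t (Suc (Suc i)) \<ge> 0)) \<and>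
     (AE t in lborel. t > 0 \<longrightarrow>
        (\<forall>i\<ge>1. ((\<lambda>s. v s i) has_real_derivative
            (lam * (v t (i - 1) - v t i) - (1 - p) * (v t i - v t (i + 1)) - g_fun lam p (v t) i))
            (at t)))"

definition is_vI :: "real \<Rightarrow> real \<Rightarrow> (nat \<Rightarrow> real) \<Rightarrow> bool" where
  "is_vI lam p w \<longleftrightarrow> w \<in> V_bar_inf \<and>
     (\<forall>i\<ge>1. lam * (w (i - 1) - w i) - (1 - p) * (w i - w (i + 1)) - g_fun lam p w i = 0)"

end

theory Submission
  imports Defs
begin

text \<open>The fluid model is cooperative, so solutions can be compared with explicit barriers. The
equilibrium is \<open>v\<^sub>i = \<Sum>j\<ge>i. s\<^sub>j\<close> with \<open>s\<^sub>0 = 1\<close> and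
\<open>s\<^sub>k\<^sub>+\<^sub>1 = max 0 ((\<lambda> s\<^sub>k - p) / (1 - p))\<close>. Replacing \<open>\<lambda>\<close> by a slightly larger \<open>x < 1\<close>
gives a strict supersolution, and so does its translate by \<open>n\<close> places to the right, extended by
\<open>s = 1\<close>. For large \<open>n\<close> the translate, plus a small constant, lies above the initial condition;
moving the translate back linearly from \<open>n + 1\<close> to \<open>n\<close>, slowly enough, pushes the solution below the
profile of \<open>x\<close>. From below, the profile of some \<open>x < \<lambda>\<close> is raised linearly from a level at which it is
nonpositive. Letting \<open>x\<close> tend to \<open>\<lambda>\<close> on both sides gives uniform convergence of all coordinates.\<close>

section \<open>A maximum principle for finite families of Lipschitz functions\<close>

text \<open>The images of the exceptional null set are null, so some level \<open>y\<close> avoids them; at the last time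
the maximum of the \<open>f i\<close> is at most \<open>y\<close>, it would have to decrease.\<close>

lemma lipschitz_family_nonpos:
  fixes f :: "'i \<Rightarrow> real \<Rightarrow> real"
  assumes I: "finite I"
    and lip: "\<And>i. i \<in> I \<Longrightarrow> \<exists>L. L-lipschitz_on {a..b} (f i)"
    and null: "negligible Z"
    and init: "\<And>i. i \<in> I \<Longrightarrow> f i a \<le> 0"
    and deriv: "\<And>t i. \<lbrakk>a < t; t < b; t \<notin> Z; i \<in> I; 0 < f i t; \<And>j. j \<in> I \<Longrightarrow> f j t \<le> f i t\<rbrakk>
      \<Longrightarrow> \<exists>D<0. (f i has_real_derivative D) (at t)"
    and k: "k \<in> I" and ab: "a \<le> b"
  shows "f k b \<le> 0"
proof (rule ccontr)
  assume pos: "\<not> f k b \<le> 0"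
  have "negligible (f i ` (Z \<inter> {a..b}))" if i: "i \<in> I" for i
  proof (rule negligible_locally_Lipschitz_image)
    obtain L where "L-lipschitz_on {a..b} (f i)"
      using lip[OF i] by blast
    then have *: "norm (f i y - f i x) \<le> L * norm (y - x)"
      if "x \<in> {a..b}" "y \<in> {a..b}" for x y
      using that by (auto simp: lipschitz_on_def dist_norm)
    show "\<exists>T B. open T \<and> x \<in> T \<and> (\<forall>y \<in> Z \<inter> {a..b} \<inter> T. norm (f i y - f i x) \<le> B * norm (y - x))"
      if "x \<in> Z \<inter> {a..b}" for x
      using * that by (intro exI[of _ UNIV] exI[of _ L]) auto
  qed (use null in \<open>auto intro: negligible_Int\<close>)
  then have "negligible (\<Union>i\<in>I. f i ` (Z \<inter> {a..b}))"
    using I by (intro negligible_Union) auto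
  moreover have "\<not> negligible {0<..<f k b}"
    using pos negligible_interval(2)[of 0 "f k b"] by (simp add: box_real)
  ultimately obtain y where y: "y \<in> {0<..<f k b}" "y \<notin> (\<Union>i\<in>I. f i ` (Z \<inter> {a..b}))"
    by (meson negligible_subset subsetI)
  define K where "K = {t \<in> {a..b}. \<forall>i\<in>I. f i t \<le> y}"
  have cont: "continuous_on {a..b} (f i)" if "i \<in> I" for i
    using lip[OF that] lipschitz_on_continuous_on by blast
  have "closed ({a..b} \<inter> (\<Inter>i\<in>I. {t \<in> {a..b}. f i t \<le> y}))"
    using cont by (intro closed_Int closed_INT ballI continuous_on_closed_Collect_le) auto
  moreover have "{a..b} \<inter> (\<Inter>i\<in>I. {t \<in> {a..b}. f i t \<le> y}) = K"
    unfolding K_def by auto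
  ultimately have "closed K" by simp
  moreover have aK: "a \<in> K"
    using init ab y(1) unfolding K_def by force
  moreover have bdd: "bdd_above K" unfolding K_def by auto
  ultimately have cK: "Sup K \<in> K"
    using closed_contains_Sup by blast
  define c where "c = Sup K"
  have c: "a \<le> c" "c \<le> b" "\<And>i. i \<in> I \<Longrightarrow> f i c \<le> y"
    using cK unfolding c_def K_def by auto
  have "c \<noteq> b" using c(3)[OF k] y(1) by auto
  with c have "c < b" by simp
  \<comment> \<open>A function below \<open>y\<close> at \<open>c\<close> stays below by continuity.
    One equal to \<open>y\<close> is maximal there, and \<open>c\<close> lies outside
    \<open>Z\<close> by the choice of \<open>y\<close>, so its derivative is negative. Either way
    \<open>c\<close> is not the last element of \<open>K\<close>.\<close>
  have "\<forall>\<^sub>F t in at_right c. f i t \<le> y" if i: "i \<in> I" for i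
  proof (cases "f i c < y")
    case True
    have "continuous (at c within {c..b}) (f i)"
      using continuous_on_subset[OF cont[OF i], of "{c..b}"] c \<open>c < b\<close>
      by (auto simp: continuous_on_eq_continuous_within)
    then have "(f i \<longlongrightarrow> f i c) (at_right c)"
      using \<open>c < b\<close> by (simp add: continuous_within at_within_Icc_at_right)
    from order_tendstoD(2)[OF this True] show ?thesis
      by (rule eventually_mono) simp
  next
    case False
    with c(3)[OF i] have eq: "f i c = y" by simp
    with init[OF i] y(1) have "c \<noteq> a" by auto
    moreover have "c \<notin> Z"
      using y(2) eq c i by force
    ultimately obtain D where "D < 0" "(f i has_real_derivative D) (at c)"
      using deriv[of c i] c i y(1) eq \<open>c < b\<close> by auto
    then obtain d where "d > 0" "\<And>h. 0 < h \<Longrightarrow> h < d \<Longrightarrow> f i (c + h) < f i c"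
      using DERIV_neg_dec_right by blast
    then have "\<And>t. c < t \<Longrightarrow> t < c + d \<Longrightarrow> f i t \<le> y"
      using eq by (metis add_diff_cancel_left' diff_add_cancel add.commute diff_gt_0_iff_gt
          less_diff_eq less_eq_real_def)
    then show ?thesis
      using \<open>d > 0\<close> unfolding eventually_at_right_field by (intro exI[of _ "c + d"]) auto
  qed
  then have "\<forall>\<^sub>F t in at_right c. \<forall>i\<in>I. f i t \<le> y"
    using I by (simp add: eventually_ball_finite)
  then obtain e where e: "e > c" "\<And>t. c < t \<Longrightarrow> t < e \<Longrightarrow> \<forall>i\<in>I. f i t \<le> y"
    unfolding eventually_at_right_field by blast
  obtain t where "c < t" "t < min e b"
    using e(1) \<open>c < b\<close> by (meson dense min_less_iff_conj)
  then have "t \<in> K"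
    using e(2)[of t] c unfolding K_def by auto
  then have "t \<le> c"
    unfolding c_def using bdd by (rule cSup_upper)
  with \<open>c < t\<close> show False by simp
qed

section \<open>States, tails and derivatives of fluid solutions\<close>

lemma V_bar_inf_D:
  assumes "v \<in> V_bar_inf"
  shows "v \<longlonglongrightarrow> 0" "0 \<le> v i" "v (Suc i) \<le> v i"
    "v i = (\<Sum>j. v (j + i) - v (Suc (j + i)))" "v 0 - v 1 = 1"
proof -
  obtain s where s: "s 0 = 1" "\<And>i. 0 \<le> s i" "summable (\<lambda>i. s (Suc i))"
    and v: "\<And>i. v i = (\<Sum>j. s (j + i))"
    using assms unfolding V_bar_inf_def S_bar_inf_def by auto
  have "summable s" using s(3) summable_Suc_iff by blast
  then have sum: "summable (\<lambda>j. s (j + i))" for i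
    by (rule summable_ignore_initial_segment)
  have diff: "v i - v (Suc i) = s i" for i
    using suminf_split_head[OF sum[of i]] by (simp add: v)
  show "0 \<le> v i"
    unfolding v by (intro suminf_nonneg sum s)
  show "v (Suc i) \<le> v i" using diff[of i] s(2)[of i] by simp
  show "v i = (\<Sum>j. v (j + i) - v (Suc (j + i)))"
    unfolding diff by (rule v)
  show "v 0 - v 1 = 1" using diff[of 0] s(1) by simp
  show "v \<longlonglongrightarrow> 0"
    using suminf_exist_split[OF _ \<open>summable s\<close>] by (intro LIMSEQ_I) (simp add: v)
qed

lemma fluid_solution_V_bar_inf:
  assumes "fluid_solution lam p v0 v" "0 \<le> t"
  shows "v t \<in> V_bar_inf"
  using assms unfolding fluid_solution_def by blast

text \<open>Dini's argument: the tails of a solution are small uniformly on compact time intervals.\<close>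

lemma fluid_solution_uniform_tail:
  assumes sol: "fluid_solution lam p v0 v" and a: "0 \<le> a" and e: "0 < e"
  obtains N where "\<And>t i. t \<in> {a..b} \<Longrightarrow> N \<le> i \<Longrightarrow> v t i < e"
proof -
  note V = fluid_solution_V_bar_inf[OF sol]
  obtain L where L: "\<And>i. L-lipschitz_on {0..} (\<lambda>t. v t i)"
    using sol by (auto simp: fluid_solution_def)
  then have "0 \<le> L" by (auto simp: lipschitz_on_def)
  \<comment> \<open>Moving by less than \<open>d\<close> in time changes a coordinate by at most
    \<open>e / 2\<close>; the summand 1 covers \<open>L = 0\<close>.\<close>
  define d where "d = e / (2 * (L + 1))"
  have "d > 0" using e \<open>0 \<le> L\<close> by (simp add: d_def)
  have Ld: "L * d \<le> e / 2"
    using e \<open>0 \<le> L\<close> unfolding d_def by (simp add: field_simps)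
  have "\<forall>t\<in>{a..b}. \<exists>N. \<forall>i\<ge>N. v t i < e / 2"
  proof
    fix t assume "t \<in> {a..b}"
    then have "v t \<longlonglongrightarrow> 0" using V_bar_inf_D(1)[OF V] a by simp
    from order_tendstoD(2)[OF this, of "e / 2"] e show "\<exists>N. \<forall>i\<ge>N. v t i < e / 2"
      unfolding eventually_sequentially by simp
  qed
  then obtain M where M: "\<And>t i. t \<in> {a..b} \<Longrightarrow> M t \<le> i \<Longrightarrow> v t i < e / 2"
    by metis
  obtain C where C: "C \<subseteq> {a..b}" "finite C" "{a..b} \<subseteq> (\<Union>t\<in>C. ball t d)"
  proof (rule compactE_image[of "{a..b}" "{a..b}" "\<lambda>t. ball t d"])
    show "{a..b} \<subseteq> (\<Union>t\<in>{a..b}. ball t d)"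
      using \<open>d > 0\<close> by (intro subsetI UN_I) auto
  qed auto
  show thesis
  proof
    fix t i assume t: "t \<in> {a..b}" and i: "Max (insert 0 (M ` C)) \<le> i"
    obtain s where s: "s \<in> C" "dist s t < d" using C(3) t by auto
    then have "M s \<le> i" using i C(2) by simp
    then have "v s i < e / 2" using M s C(1) by blast
    moreover have "\<bar>v t i - v s i\<bar> \<le> L * dist t s"
      using lipschitz_onD[OF L, of t s i] t s(1) C(1) a by (auto simp: dist_norm)
    moreover have "L * dist t s \<le> L * d"
      using s(2) \<open>0 \<le> L\<close> by (intro mult_left_mono) (auto simp: dist_commute)
    ultimately show "v t i < e" using Ld by linarith
  qed
qed

lemma fluid_solution_deriv:
  assumes "fluid_solution lam p v0 v"
  obtains Z where "negligible Z"
    "\<And>t i. 0 < t \<Longrightarrow> t \<notin> Z \<Longrightarrow> 1 \<le> i \<Longrightarrow> ((\<lambda>s. v s i) has_real_derivative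
       (lam * (v t (i - 1) - v t i) - (1 - p) * (v t i - v t (i + 1)) - g_fun lam p (v t) i)) (at t)"
proof -
  obtain Z where "Z \<in> null_sets lborel" and Z:
    "{t \<in> space lborel. \<not> (t > 0 \<longrightarrow> (\<forall>i\<ge>1. ((\<lambda>s. v s i) has_real_derivative
       (lam * (v t (i - 1) - v t i) - (1 - p) * (v t i - v t (i + 1)) - g_fun lam p (v t) i)) (at t)))} \<subseteq> Z"
    using assms unfolding fluid_solution_def eventually_ae_filter by blast
  have "negligible Z"
    using \<open>Z \<in> null_sets lborel\<close> by (simp add: negligible_iff_null_sets null_sets_completionI)
  with Z show thesis by (intro that[of Z]) auto
qed

section \<open>Comparison with barriers that are affine in time\<close>

lemma lipschitz_on_affine_diff:
  fixes f :: "real \<Rightarrow> real"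
  assumes "L-lipschitz_on {0..} f" "0 \<le> a"
  shows "\<exists>L. L-lipschitz_on {a..b} (\<lambda>t. f t - (A + B * (t - a)))"
    "\<exists>L. L-lipschitz_on {a..b} (\<lambda>t. (A + B * (t - a)) - f t)"
proof -
  have f: "L-lipschitz_on {a..b} f"
    using assms lipschitz_on_subset by fastforce
  have g: "\<bar>B\<bar>-lipschitz_on {a..b} (\<lambda>t. A + B * (t - a))"
    by (intro lipschitz_onI) (auto simp: dist_real_def abs_mult[symmetric] algebra_simps)
  show "\<exists>L. L-lipschitz_on {a..b} (\<lambda>t. f t - (A + B * (t - a)))"
    "\<exists>L. L-lipschitz_on {a..b} (\<lambda>t. (A + B * (t - a)) - f t)"
    using lipschitz_on_diff[OF f g] lipschitz_on_diff[OF g f] by blast+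
qed

text \<open>Where \<open>v - X\<close> is positive and maximal, both neighbouring differences favour
  \<open>X\<close>, so by \<open>lam \<ge> 0\<close> and \<open>p \<le> 1\<close> the drift of
  \<open>v\<close> is at most that of \<open>X\<close>. There \<open>v\<close> exceeds
  \<open>X \<ge> e > 0\<close>, hence \<open>g_fun\<close> equals \<open>p\<close>, and
  \<open>super\<close> makes \<open>v - X\<close> decrease. The margin \<open>e\<close> also reduces
  the problem to finitely many coordinates: from some index on,
  \<open>v < e \<le> X\<close>.\<close>

lemma fluid_solution_le_barrier:
  assumes sol: "fluid_solution lam p v0 v" and lam: "0 \<le> lam" and p: "p \<le> 1"
    and a: "0 \<le> a" "a \<le> b" and e: "0 < e"
    and X: "\<And>t i. X t i = A i + B i * (t - a)"
    and pos: "\<And>t i. t \<in> {a..b} \<Longrightarrow> e \<le> X t i"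
    and bdry: "\<And>t. t \<in> {a..b} \<Longrightarrow> X t 0 - X t 1 = 1"
    and super: "\<And>t i. t \<in> {a..b} \<Longrightarrow> 1 \<le> i \<Longrightarrow>
      lam * (X t (i - 1) - X t i) - (1 - p) * (X t i - X t (i + 1)) - p < B i"
    and init: "\<And>i. v a i \<le> X a i"
  shows "v b i \<le> X b i"
proof -
  note V = fluid_solution_V_bar_inf[OF sol]
  obtain L where L: "\<And>i. L-lipschitz_on {0..} (\<lambda>t. v t i)"
    using sol by (auto simp: fluid_solution_def)
  obtain N where N: "\<And>t i. t \<in> {a..b} \<Longrightarrow> N \<le> i \<Longrightarrow> v t i < e"
    using fluid_solution_uniform_tail[OF sol a(1) e] by blast
  obtain Z where Z: "negligible Z" and dv:
    "\<And>t i. 0 < t \<Longrightarrow> t \<notin> Z \<Longrightarrow> 1 \<le> i \<Longrightarrow> ((\<lambda>s. v s i) has_real_derivative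
       (lam * (v t (i - 1) - v t i) - (1 - p) * (v t i - v t (i + 1)) - g_fun lam p (v t) i)) (at t)"
    using fluid_solution_deriv[OF sol] by blast
  define f where "f i t = v t i - X t i" for i t
  have main: "f k b \<le> 0" if "k \<in> {1..N}" for k
  proof (rule lipschitz_family_nonpos[where I = "{1..N}" and a = a and b = b and Z = Z and f = f])
    fix i show "\<exists>L. L-lipschitz_on {a..b} (f i)"
      using lipschitz_on_affine_diff(1)[OF L a(1)] by (simp add: f_def X)
  next
    fix t i assume t: "a < t" "t < b" "t \<notin> Z" and i: "i \<in> {1..N}" and ft: "0 < f i t"
      and max: "\<And>j. j \<in> {1..N} \<Longrightarrow> f j t \<le> f i t"
    have tab: "t \<in> {a..b}" and "0 < t" using t a by auto
    \<comment> \<open>Both \<open>v\<close> and \<open>X\<close> have first difference 1, so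
      coordinate 0 copies coordinate 1 and the neighbour on the left of \<open>i = 1\<close> causes
      no loss.\<close>
    have f0: "f 0 t = f 1 t"
      using bdry[OF tab] V_bar_inf_D(5)[OF V, of t] \<open>0 < t\<close> by (simp add: f_def)
    have "f (i - 1) t \<le> f i t"
    proof (cases "i = 1")
      case True then show ?thesis using f0 by simp
    next
      case False
      then have "i - 1 \<in> {1..N}" using i by auto
      then show ?thesis by (rule max)
    qed
    moreover have "f (i + 1) t \<le> f i t"
    proof (cases "i + 1 \<le> N")
      case True then show ?thesis using max[of "i + 1"] by simp
    next
      case False
      then have "v t (i + 1) < e" using N[OF tab] by simp
      then show ?thesis using pos[OF tab, of "i + 1"] ft unfolding f_def by linarith
    qed
    ultimately have "lam * (v t (i - 1) - v t i) \<le> lam * (X t (i - 1) - X t i)"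
      "(1 - p) * (X t i - X t (i + 1)) \<le> (1 - p) * (v t i - v t (i + 1))"
      using lam p by (auto simp: f_def intro!: mult_left_mono)
    moreover have "0 < v t i" using ft pos[OF tab, of i] e unfolding f_def by linarith
    then have "g_fun lam p (v t) i = p" by (simp add: g_fun_def)
    ultimately have neg: "lam * (v t (i - 1) - v t i) - (1 - p) * (v t i - v t (i + 1))
        - g_fun lam p (v t) i - B i < 0"
      using super[OF tab, of i] i by simp
    have "(f i has_real_derivative (lam * (v t (i - 1) - v t i) - (1 - p) * (v t i - v t (i + 1))
        - g_fun lam p (v t) i - B i)) (at t)"
      unfolding f_def X using dv[OF \<open>0 < t\<close> t(3), of i] i
      by (auto intro!: derivative_eq_intros)
    with neg show "\<exists>D<0. (f i has_real_derivative D) (at t)" by blast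
  qed (use that Z a init in \<open>auto simp: f_def\<close>)
  have "b \<in> {a..b}" using a by simp
  have ge1: "v b i \<le> X b i" if "1 \<le> i" for i
    using main[of i] N[OF \<open>b \<in> {a..b}\<close>, of i] pos[OF \<open>b \<in> {a..b}\<close>, of i] that
    by (cases "i \<le> N") (auto simp: f_def)
  show ?thesis
    using ge1[of i] ge1[of 1] bdry[OF \<open>b \<in> {a..b}\<close>] V_bar_inf_D(5)[OF V, of b] a
    by (cases "i = 0") auto
qed

text \<open>The mirror image of the upper comparison. As \<open>v \<ge> 0\<close>, the barrier can
  exceed \<open>v\<close> only where \<open>X > 0\<close>, so the differential inequality is
  demanded only there, and \<open>X\<close> may be negative elsewhere. The bound
  \<open>g_fun \<le> p\<close> now points in the right direction whether or not \<open>v\<close>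
  vanishes.\<close>

lemma fluid_solution_ge_barrier:
  assumes sol: "fluid_solution lam p v0 v" and lam: "0 \<le> lam" and p: "0 \<le> p" "p \<le> 1"
    and a: "0 \<le> a" "a \<le> b"
    and X: "\<And>t i. X t i = A i + B i * (t - a)"
    and N: "\<And>t i. t \<in> {a..b} \<Longrightarrow> N \<le> i \<Longrightarrow> X t i \<le> 0"
    and bdry: "\<And>t. t \<in> {a..b} \<Longrightarrow> X t 0 - X t 1 = 1"
    and sub: "\<And>t i. t \<in> {a..b} \<Longrightarrow> 1 \<le> i \<Longrightarrow> 0 < X t i \<Longrightarrow>
      B i < lam * (X t (i - 1) - X t i) - (1 - p) * (X t i - X t (i + 1)) - p"
    and init: "\<And>i. 1 \<le> i \<Longrightarrow> X a i \<le> v a i"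
  shows "X b i \<le> v b i"
proof -
  note V = fluid_solution_V_bar_inf[OF sol]
  obtain L where L: "\<And>i. L-lipschitz_on {0..} (\<lambda>t. v t i)"
    using sol by (auto simp: fluid_solution_def)
  obtain Z where Z: "negligible Z" and dv:
    "\<And>t i. 0 < t \<Longrightarrow> t \<notin> Z \<Longrightarrow> 1 \<le> i \<Longrightarrow> ((\<lambda>s. v s i) has_real_derivative
       (lam * (v t (i - 1) - v t i) - (1 - p) * (v t i - v t (i + 1)) - g_fun lam p (v t) i)) (at t)"
    using fluid_solution_deriv[OF sol] by blast
  define f where "f i t = X t i - v t i" for i t
  have main: "f k b \<le> 0" if "k \<in> {1..N}" for k
  proof (rule lipschitz_family_nonpos[where I = "{1..N}" and a = a and b = b and Z = Z and f = f])
    fix i show "\<exists>L. L-lipschitz_on {a..b} (f i)"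
      using lipschitz_on_affine_diff(2)[OF L a(1)] by (simp add: f_def X)
  next
    fix t i assume t: "a < t" "t < b" "t \<notin> Z" and i: "i \<in> {1..N}" and ft: "0 < f i t"
      and max: "\<And>j. j \<in> {1..N} \<Longrightarrow> f j t \<le> f i t"
    have tab: "t \<in> {a..b}" and "0 < t" using t a by auto
    have nonneg: "0 \<le> v t j" for j using V_bar_inf_D(2)[OF V] \<open>0 < t\<close> by simp
    have f0: "f 0 t = f 1 t"
      using bdry[OF tab] V_bar_inf_D(5)[OF V, of t] \<open>0 < t\<close> by (simp add: f_def)
    have "f (i - 1) t \<le> f i t"
    proof (cases "i = 1")
      case True then show ?thesis using f0 by simp
    next
      case False
      then have "i - 1 \<in> {1..N}" using i by auto
      then show ?thesis by (rule max)
    qed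
    moreover have "f (i + 1) t \<le> f i t"
    proof (cases "i + 1 \<le> N")
      case True then show ?thesis using max[of "i + 1"] by simp
    next
      case False
      then have "X t (i + 1) \<le> 0" using N[OF tab] by simp
      then show ?thesis using nonneg[of "i + 1"] ft unfolding f_def by linarith
    qed
    ultimately have "lam * (X t (i - 1) - X t i) \<le> lam * (v t (i - 1) - v t i)"
      "(1 - p) * (v t i - v t (i + 1)) \<le> (1 - p) * (X t i - X t (i + 1))"
      using lam p by (auto simp: f_def intro!: mult_left_mono)
    moreover have "0 < X t i" using ft nonneg[of i] unfolding f_def by linarith
    moreover have "g_fun lam p (v t) i \<le> p" using p by (simp add: g_fun_def)
    ultimately have neg: "B i - (lam * (v t (i - 1) - v t i) - (1 - p) * (v t i - v t (i + 1))
        - g_fun lam p (v t) i) < 0"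
      using sub[OF tab, of i] i by simp
    have "(f i has_real_derivative (B i - (lam * (v t (i - 1) - v t i) - (1 - p) * (v t i - v t (i + 1))
        - g_fun lam p (v t) i))) (at t)"
      unfolding f_def X using dv[OF \<open>0 < t\<close> t(3), of i] i
      by (auto intro!: derivative_eq_intros)
    with neg show "\<exists>D<0. (f i has_real_derivative D) (at t)" by blast
  qed (use that Z a init in \<open>auto simp: f_def\<close>)
  have "b \<in> {a..b}" using a by simp
  have ge1: "X b i \<le> v b i" if "1 \<le> i" for i
    using main[of i] N[OF \<open>b \<in> {a..b}\<close>, of i] V_bar_inf_D(2)[OF V, of b i] a that
    by (cases "i \<le> N") (auto simp: f_def)
  show ?thesis
    using ge1[of i] ge1[of 1] bdry[OF \<open>b \<in> {a..b}\<close>] V_bar_inf_D(5)[OF V, of b] a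
    by (cases "i = 0") auto
qed

section \<open>Equilibrium occupancies and the tails of their translates\<close>

text \<open>For \<open>p = 1\<close> the quotient is a division by zero, and its value 0 is the right one.\<close>

primrec eq_occ :: "real \<Rightarrow> real \<Rightarrow> nat \<Rightarrow> real" where
  "eq_occ x p 0 = 1"
| "eq_occ x p (Suc k) = max 0 ((x * eq_occ x p k - p) / (1 - p))"

text \<open>The truncated subtraction is intended: it extends the occupancies by \<open>eq_occ x p 0 = 1\<close> to the
indices below \<open>n\<close>.\<close>

definition shifted_tail :: "real \<Rightarrow> real \<Rightarrow> nat \<Rightarrow> nat \<Rightarrow> real" where
  "shifted_tail x p n i = (\<Sum>j. eq_occ x p (j + i - n))"

lemma eq_occ_nonneg: "0 \<le> eq_occ x p k"
  by (cases k) auto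

text \<open>If \<open>r \<le> 1\<close> then \<open>m * r \<le> 1\<close>, so
  \<open>x * r - p \<le> m * r - p * (m * r) = (1 - p) * (m * r)\<close>. The nonnegative majorant
  \<open>m\<close> is kept apart from \<open>x\<close> because the lower barriers may use a negative
  \<open>x\<close>.\<close>

lemma eq_occ_bounds:
  assumes "x \<le> m" "0 \<le> m" "m \<le> 1" "0 \<le> p" "p \<le> 1"
  shows "eq_occ x p k \<le> 1" and "eq_occ x p (Suc k) \<le> m * eq_occ x p k"
proof -
  have step: "eq_occ x p (Suc k) \<le> m * eq_occ x p k" if "eq_occ x p k \<le> 1" for k
  proof (cases "p = 1")
    case False
    have r: "0 \<le> eq_occ x p k" by (rule eq_occ_nonneg)
    have "x * eq_occ x p k \<le> m * eq_occ x p k"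
      using assms r by (intro mult_right_mono)
    moreover have "m * eq_occ x p k \<le> 1"
      using assms r that by (simp add: mult_le_one)
    then have "p * (m * eq_occ x p k) \<le> p * 1"
      using assms by (intro mult_left_mono)
    ultimately have "x * eq_occ x p k - p \<le> m * eq_occ x p k * (1 - p)"
      by (simp add: algebra_simps)
    then show ?thesis
      using assms r False by (simp add: pos_divide_le_eq)
  qed (use assms eq_occ_nonneg in simp)
  show le1: "eq_occ x p k \<le> 1" for k
  proof (induction k)
    case (Suc k)
    have "m * eq_occ x p k \<le> 1"
      using assms Suc eq_occ_nonneg by (simp add: mult_le_one)
    with step[OF Suc] show ?case by simp
  qed simp
  then show "eq_occ x p (Suc k) \<le> m * eq_occ x p k" by (rule step)
qed

lemma eq_occ_add_le:
  assumes "x \<le> m" "0 \<le> m" "m \<le> 1" "0 \<le> p" "p \<le> 1"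
  shows "eq_occ x p (j + i) \<le> m ^ j * eq_occ x p i"
proof (induction j)
  case (Suc j)
  have "eq_occ x p (Suc (j + i)) \<le> m * eq_occ x p (j + i)"
    by (rule eq_occ_bounds) fact+
  also have "\<dots> \<le> m * (m ^ j * eq_occ x p i)"
    using Suc assms by (intro mult_left_mono)
  finally show ?case by (simp add: mult.assoc)
qed simp

lemma eq_occ_Suc_le:
  assumes "x \<le> 1" "0 \<le> p" "p \<le> 1"
  shows "eq_occ x p (Suc k) \<le> eq_occ x p k"
  using eq_occ_bounds(2)[of x 1 p k] assms by simp

lemma summable_eq_occ:
  assumes "x < 1" "0 \<le> p" "p \<le> 1"
  shows "summable (\<lambda>j. eq_occ x p (j + i - n))"
proof -
  have le: "eq_occ x p j \<le> max x 0 ^ j" for j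
    using eq_occ_add_le[of x "max x 0" p j 0] assms by simp
  have "summable (eq_occ x p)"
    by (rule summable_comparison_test'[of "\<lambda>j. max x 0 ^ j" 0])
       (use le assms in \<open>auto simp: eq_occ_nonneg intro!: summable_geometric\<close>)
  \<comment> \<open>After dropping the first \<open>n\<close> terms the subtraction is no longer
    truncated.\<close>
  then have "summable (\<lambda>j. eq_occ x p ((j + n) + i - n))"
    using summable_ignore_initial_segment[of "eq_occ x p" i]
    by (simp add: add.commute add.left_commute)
  then show ?thesis
    using summable_iff_shift[of "\<lambda>j. eq_occ x p (j + i - n)" n] by simp
qed

lemma shifted_tail_diff:
  assumes "x < 1" "0 \<le> p" "p \<le> 1"
  shows "shifted_tail x p n i - shifted_tail x p n (Suc i) = eq_occ x p (i - n)"
  using suminf_split_head[OF summable_eq_occ[OF assms, of i n]]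
  by (simp add: shifted_tail_def)

lemma shifted_tail_Suc:
  assumes "x < 1" "0 \<le> p" "p \<le> 1"
  shows "shifted_tail x p (Suc n) i = shifted_tail x p n i + eq_occ x p (i - Suc n)"
  using suminf_split_head[OF summable_eq_occ[OF assms, of i "Suc n"]]
  by (simp add: shifted_tail_def)

lemma shifted_tail_nonneg:
  assumes "x < 1" "0 \<le> p" "p \<le> 1"
  shows "0 \<le> shifted_tail x p n i"
  unfolding shifted_tail_def by (intro suminf_nonneg summable_eq_occ assms eq_occ_nonneg)

text \<open>The indices below \<open>n\<close> carry occupancy 1, which lets a far translate
  dominate any given initial state.\<close>

lemma shifted_tail_ge:
  assumes "x < 1" "0 \<le> p" "p \<le> 1"
  shows "real (n - i) \<le> shifted_tail x p n i"
proof (induction n)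
  case (Suc n)
  then show ?case
    using shifted_tail_nonneg[OF assms, of n i] shifted_tail_nonneg[OF assms, of "Suc n" i]
    by (cases "i \<le> n") (auto simp: shifted_tail_Suc[OF assms] Suc_diff_le)
qed (simp add: shifted_tail_nonneg assms)

text \<open>Geometric decay of the occupancies. It turns a lower bound on a tail into one on the
  occupancy at the same index.\<close>

lemma shifted_tail_0_le:
  assumes "x \<le> m" "0 \<le> m" "m < 1" "0 \<le> p" "p \<le> 1"
  shows "shifted_tail x p 0 i \<le> eq_occ x p i / (1 - m)"
proof -
  have "shifted_tail x p 0 i \<le> (\<Sum>j. m ^ j * eq_occ x p i)"
    unfolding shifted_tail_def using assms
    by (intro suminf_le summable_eq_occ summable_mult2 summable_geometric)
       (auto intro: eq_occ_add_le)
  also have "\<dots> = eq_occ x p i / (1 - m)"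
    using assms by (subst suminf_mult2[symmetric]) (auto simp: suminf_geometric summable_geometric)
  finally show ?thesis .
qed

text \<open>The recursion for \<open>x\<close> gives \<open>x * r - p \<le> (1 - p) * r'\<close> for
  consecutive occupancies \<open>r\<close>, \<open>r'\<close>, so the drift with \<open>lam\<close>
  is at most \<open>- (x - lam) * r\<close>. Giving up half of this makes the inequality strict when
  \<open>r > 0\<close>. Left of the translate both occupancies are 1 and the drift is
  \<open>lam - 1\<close>.\<close>

lemma eq_occ_supersolution:
  assumes "0 \<le> lam" "lam < x" "x < 1" "0 \<le> p" "p \<le> 1"
  shows "lam * eq_occ x p (k - n) - (1 - p) * eq_occ x p (Suc k - n) - p
    < - ((x - lam) / 2) * eq_occ x p (k - n)"
proof (cases "k < n")
  case True
  then show ?thesis using assms by (simp add: field_simps)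
next
  case False
  define r where "r = eq_occ x p (k - n)"
  have "x * r - p \<le> (1 - p) * eq_occ x p (Suc (k - n))"
  proof (cases "p = 1")
    case True
    then show ?thesis
      using assms eq_occ_bounds(1)[of x 1 p "k - n"] eq_occ_nonneg[of x p "k - n"]
      by (simp add: r_def mult_le_one)
  next
    case False
    then have "x * r - p = (1 - p) * ((x * r - p) / (1 - p))" by simp
    also have "\<dots> \<le> (1 - p) * eq_occ x p (Suc (k - n))"
      using assms by (intro mult_left_mono) (auto simp: r_def)
    finally show ?thesis .
  qed
  then have *: "lam * r - (1 - p) * eq_occ x p (Suc (k - n)) - p \<le> - (x - lam) * r"
    by (simp add: algebra_simps)
  show ?thesis
  proof (cases "r = 0")
    case True
    \<comment> \<open>When \<open>r = 0\<close> strictness must come from \<open>p\<close>; for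
      \<open>p = 0\<close> all occupancies are positive, since \<open>x > 0\<close>.\<close>
    have "p \<noteq> 0"
    proof
      assume "p = 0"
      have "0 < eq_occ x 0 j" for j
        using assms by (induction j) (auto simp: less_max_iff_disj)
      with True \<open>p = 0\<close> show False by (simp add: r_def less_le)
    qed
    then have "0 < p" using assms by simp
    moreover have "0 \<le> (1 - p) * eq_occ x p (Suc (k - n))"
      using assms eq_occ_nonneg by (intro mult_nonneg_nonneg) auto
    ultimately have "- ((1 - p) * eq_occ x p (Suc (k - n))) < p" by linarith
    then show ?thesis
      using False True by (simp add: r_def[symmetric] Suc_diff_le del: eq_occ.simps)
  next
    case r0: False
    then have "0 < r" using eq_occ_nonneg[of x p "k - n"] by (simp add: r_def)
    then have "- (x - lam) * r < - ((x - lam) / 2) * r"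
      using assms by (intro mult_strict_right_mono) (auto simp: field_simps)
    with * False show ?thesis
      by (simp add: r_def[symmetric] Suc_diff_le del: eq_occ.simps)
  qed
qed

section \<open>Eventual upper bound\<close>

lemma fluid_solution_upper_init:
  assumes sol: "fluid_solution lam p v0 v"
    and par: "0 \<le> lam" "lam < x" "x < 1" "0 \<le> p" "p \<le> 1" and e: "0 < e"
  shows "\<exists>n. \<forall>t\<ge>0. \<forall>i. v t i \<le> shifted_tail x p n i + e"
proof -
  have xp: "x < 1" "0 \<le> p" "p \<le> 1" by fact+
  have V: "v 0 \<in> V_bar_inf"
    using fluid_solution_V_bar_inf[OF sol] by simp
  obtain N where N: "\<And>i. N \<le> i \<Longrightarrow> v 0 i < e"
    using order_tendstoD(2)[OF V_bar_inf_D(1)[OF V] e] unfolding eventually_sequentially by blast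
  obtain M where M: "v 0 0 \<le> real M" using real_arch_simple by blast
  have dec: "v 0 i \<le> v 0 0" for i
    by (induction i) (use V_bar_inf_D(3)[OF V] order_trans in blast)+
  \<comment> \<open>Below index \<open>N\<close> the translate is at least
    \<open>n - i \<ge> M \<ge> v 0 0\<close>; from \<open>N\<close> on, the constant
    \<open>e\<close> suffices.\<close>
  define n where "n = N + M"
  have init: "v 0 i \<le> shifted_tail x p n i + e" for i
  proof (cases "N \<le> i")
    case True
    then show ?thesis using N[OF True] shifted_tail_nonneg[OF xp, of n i] by simp
  next
    case False
    then have "v 0 i \<le> real (n - i)"
      using M dec[of i] by (simp add: n_def)
    also have "\<dots> \<le> shifted_tail x p n i" by (rule shifted_tail_ge[OF xp])
    finally show ?thesis using e by simp
  qed
  have "v t i \<le> shifted_tail x p n i + e" if "0 \<le> t" for t i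
  proof (rule fluid_solution_le_barrier[where a = 0 and e = e and A = "\<lambda>i. shifted_tail x p n i + e"
        and B = "\<lambda>_. 0" and X = "\<lambda>_ i. shifted_tail x p n i + e", OF sol])
    fix i :: nat
    assume "1 \<le> i"
    then obtain k where k: "i = Suc k" by (cases i) auto
    have "0 \<le> (x - lam) / 2 * eq_occ x p (k - n)"
      using par eq_occ_nonneg by (intro mult_nonneg_nonneg) auto
    then show "lam * (shifted_tail x p n (i - 1) + e - (shifted_tail x p n i + e)) -
        (1 - p) * (shifted_tail x p n i + e - (shifted_tail x p n (i + 1) + e)) - p < 0"
      using eq_occ_supersolution[OF par, of k n]
      by (simp add: k shifted_tail_diff[OF xp])
  qed (use that e par init shifted_tail_nonneg[OF xp] shifted_tail_diff[OF xp, of n 0] in auto)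
  then show ?thesis by blast
qed

lemma fluid_solution_upper_step:
  assumes sol: "fluid_solution lam p v0 v"
    and par: "0 \<le> lam" "lam < x" "x < 1" "0 \<le> p" "p \<le> 1" and e: "0 < e"
    and a: "0 \<le> a" and init: "\<And>i. v a i \<le> shifted_tail x p (Suc n) i + e"
  shows "v (a + 2 / (x - lam)) i \<le> shifted_tail x p n i + e"
proof -
  have xp: "x < 1" "0 \<le> p" "p \<le> 1" by fact+
  define h where "h = (x - lam) / 2"
  have h: "0 < h" using par by (simp add: h_def)
  define r where "r = eq_occ x p"
  \<comment> \<open>Tails of successive translates differ by \<open>r (i - Suc n)\<close>, so
    \<open>X\<close> slides linearly from translate \<open>n + 1\<close> at time \<open>a\<close> to
    translate \<open>n\<close> at time \<open>a + 1 / h\<close>. The rate \<open>h\<close> is the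
    slack in \<open>eq_occ_supersolution\<close>.\<close>
  define X where "X t i = (shifted_tail x p (Suc n) i + e) + (- h * r (i - Suc n)) * (t - a)" for t i
  have conv: "X t i = shifted_tail x p n i + e + (1 - h * (t - a)) * r (i - Suc n)" for t i
    by (simp add: X_def r_def shifted_tail_Suc[OF xp] algebra_simps)
  have diff: "X t i - X t (Suc i) = (1 - h * (t - a)) * r (i - Suc n) + h * (t - a) * r (i - n)" for t i
    using shifted_tail_diff[OF xp, of n i] by (simp add: conv r_def algebra_simps)
  have th: "0 \<le> h * (t - a)" "h * (t - a) \<le> 1" if "t \<in> {a..a + 1 / h}" for t
    using that h by (auto simp: field_simps)
  have "v (a + 1 / h) i \<le> X (a + 1 / h) i"
  proof (rule fluid_solution_le_barrier[where a = a and e = e and X = X, OF sol])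
    show "X t i = (shifted_tail x p (Suc n) i + e) + (- h * r (i - Suc n)) * (t - a)" for t i
      by (rule X_def)
    show "e \<le> X t i" if "t \<in> {a..a + 1 / h}" for t i
      using th[OF that] shifted_tail_nonneg[OF xp, of n i] eq_occ_nonneg[of x p "i - Suc n"]
      by (simp add: conv r_def)
    show "X t 0 - X t 1 = 1" for t
      using diff[of t 0] by (simp add: r_def)
    show "v a i \<le> X a i" for i using init by (simp add: X_def)
  next
    fix t and i :: nat assume t: "t \<in> {a..a + 1 / h}" and "1 \<le> i"
    then obtain k where k: "i = Suc k" by (cases i) auto
    define q where "q = h * (t - a)"
    \<comment> \<open>The occupancies of \<open>X\<close> are convex combinations, with weight
      \<open>q\<close>, of those of the two translates, and the strict inequality
      \<open>G m < 0\<close> survives convex combination.\<close>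
    define G where "G m = lam * r (k - m) - (1 - p) * r (Suc k - m) - p + h * r (k - m)" for m
    have G: "G m < 0" for m
      using eq_occ_supersolution[OF par, of k m] by (simp add: G_def r_def h_def)
    have "(1 - q) * G (Suc n) + q * G n < 0"
      using th[OF t] G by (intro convex_bound_lt) (auto simp: q_def)
    then have "lam * (X t k - X t (Suc k)) - (1 - p) * (X t (Suc k) - X t (Suc (Suc k))) - p
        < - h * ((1 - q) * r (k - Suc n) + q * r (k - n))"
      unfolding diff q_def[symmetric] by (simp add: G_def algebra_simps)
    \<comment> \<open>The barrier sinks at rate \<open>h * r (i - Suc n)\<close>, which is
      \<open>h * r (k - n)\<close> for \<open>i = Suc k\<close>; this is the smaller of the two
      occupancies in the combination, so the slack suffices.\<close>
    also have "\<dots> \<le> - h * r (k - n)"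
    proof -
      have "r (k - n) \<le> r (k - Suc n)"
        using eq_occ_Suc_le[of x p "k - Suc n"] par unfolding r_def
        by (cases "k \<le> n") (auto simp: Suc_diff_Suc)
      then have "(1 - q) * r (k - n) \<le> (1 - q) * r (k - Suc n)"
        using th[OF t] by (intro mult_left_mono) (auto simp: q_def)
      then have "r (k - n) \<le> (1 - q) * r (k - Suc n) + q * r (k - n)"
        by (simp add: algebra_simps)
      then have "h * r (k - n) \<le> h * ((1 - q) * r (k - Suc n) + q * r (k - n))"
        using h by (intro mult_left_mono) auto
      then show ?thesis by simp
    qed
    finally show "lam * (X t (i - 1) - X t i) - (1 - p) * (X t i - X t (i + 1)) - p
        < - h * r (i - Suc n)"
      by (simp add: k)
  qed (use par a h e in auto)
  also have "\<dots> = shifted_tail x p n i + e"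
    using h by (simp add: conv)
  also have "1 / h = 2 / (x - lam)" by (simp add: h_def)
  finally show ?thesis .
qed

lemma fluid_solution_eventually_le:
  assumes sol: "fluid_solution lam p v0 v"
    and par: "0 \<le> lam" "lam < x" "x < 1" "0 \<le> p" "p \<le> 1" and e: "0 < e"
  shows "\<exists>t0. \<forall>t\<ge>t0. \<forall>i. v t i \<le> shifted_tail x p 0 i + e"
proof -
  have down: "\<exists>t0\<ge>0. \<forall>t\<ge>t0. \<forall>i. v t i \<le> shifted_tail x p 0 i + e"
    if "t0 \<ge> 0" "\<forall>t\<ge>t0. \<forall>i. v t i \<le> shifted_tail x p n i + e" for n t0
    using that
  proof (induction n arbitrary: t0)
    case (Suc n)
    show ?case
    proof (rule Suc.IH[of "t0 + 2 / (x - lam)"])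
      show "\<forall>t\<ge>t0 + 2 / (x - lam). \<forall>i. v t i \<le> shifted_tail x p n i + e"
      proof (intro allI impI)
        fix t i assume t: "t0 + 2 / (x - lam) \<le> t"
        \<comment> \<open>One step gives a bound at a single time only, so each \<open>t\<close>
          gets its own start \<open>t - 2 / (x - lam)\<close>.\<close>
        have "v ((t - 2 / (x - lam)) + 2 / (x - lam)) i \<le> shifted_tail x p n i + e"
          using Suc.prems t by (intro fluid_solution_upper_step[OF sol par e]) auto
        then show "v t i \<le> shifted_tail x p n i + e" by simp
      qed
    qed (use Suc.prems par in simp)
  qed blast
  obtain n where "\<forall>t\<ge>0. \<forall>i. v t i \<le> shifted_tail x p n i + e"
    using fluid_solution_upper_init[OF sol par e] by blast
  from down[OF order_refl this] show ?thesis by blast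
qed

section \<open>Eventual lower bound\<close>

lemma fluid_solution_eventually_ge:
  assumes sol: "fluid_solution lam p v0 v"
    and par: "0 \<le> lam" "x < lam" "lam < 1" "0 \<le> p" "p \<le> 1" and e: "0 < e"
  shows "\<exists>t0. \<forall>t\<ge>t0. \<forall>i. shifted_tail x p 0 i - e \<le> v t i"
proof -
  have xp: "x < 1" "0 \<le> p" "p \<le> 1" using par by auto
  define W where "W = shifted_tail x p 0"
  define r where "r = eq_occ x p"
  have diff: "W i - W (Suc i) = r i" for i
    using shifted_tail_diff[OF xp, of 0 i] by (simp add: W_def r_def)
  have W1: "W i \<le> W 1" if "1 \<le> i" for i
    using that
  proof (induction i rule: dec_induct)
    case (step i)
    then show ?case using diff[of i] eq_occ_nonneg[of x p i] by (simp add: r_def)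
  qed simp
  have Wlim: "\<exists>N. \<forall>i\<ge>N. W i < e"
  proof -
    have "summable r" using summable_eq_occ[OF xp, of 0 0] by (simp add: r_def)
    from suminf_exist_split[OF e this] show ?thesis
      by (auto simp: W_def shifted_tail_def r_def abs_less_iff)
  qed
  then obtain N where N: "\<And>i. N \<le> i \<Longrightarrow> W i < e" by blast
  \<comment> \<open>Where the barrier is positive, \<open>W i > e\<close>, so the occupancy exceeds
    \<open>(1 - lam) * e\<close> and the drift surplus \<open>(lam - x) * r k\<close> exceeds
    \<open>c\<close>.\<close>
  define c where "c = (lam - x) * ((1 - lam) * e)"
  have c: "0 < c" using par e by (simp add: c_def)
  \<comment> \<open>Lowered by \<open>A\<close>, the profile is nonpositive at all
    \<open>i \<ge> 1\<close>. Rising at speed \<open>c\<close>, it needs time \<open>T\<close> to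
    reach \<open>W - e\<close>; the maximum with \<open>e\<close> ensures
    \<open>T \<ge> 0\<close>.\<close>
  define A where "A = max (W 1) e"
  define T where "T = (A - e) / c"
  have T: "0 \<le> T" "c * T = A - e" using c by (auto simp: T_def A_def)
  have "W i - e \<le> v t i" if t: "T \<le> t" for t i
  proof -
    define a where "a = t - T"
    define X where "X s i = (W i - A) + c * (s - a)" for s i
    have t_eq: "t = a + T" and a: "0 \<le> a" using t by (auto simp: a_def)
    have Xle: "X s i \<le> W i - e" if "s \<in> {a..t}" for s i
    proof -
      have "c * (s - a) \<le> c * T" using that c by (intro mult_left_mono) (auto simp: a_def)
      then show ?thesis using T by (simp add: X_def)
    qed
    have "X t i \<le> v t i"
    proof (rule fluid_solution_ge_barrier[where a = a and b = t and N = N and X = X and B = "\<lambda>_. c", OF sol])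
      show "X s i = (W i - A) + c * (s - a)" for s i by (rule X_def)
      show "X s i \<le> 0" if "s \<in> {a..t}" "N \<le> i" for s i
        using Xle[OF that(1), of i] N[OF that(2)] by simp
      show "X s 0 - X s 1 = 1" for s using diff[of 0] by (simp add: X_def r_def)
      show "X a i \<le> v a i" if "1 \<le> i" for i
      proof -
        have "v a \<in> V_bar_inf" by (rule fluid_solution_V_bar_inf[OF sol a])
        from V_bar_inf_D(2)[OF this, of i] W1[OF that] show ?thesis
          by (simp add: X_def A_def)
      qed
    next
      fix s and i :: nat assume s: "s \<in> {a..t}" and i: "1 \<le> i" and Xpos: "0 < X s i"
      obtain k where k: "i = Suc k" using i by (cases i) auto
      have "e < W i" using Xle[OF s, of i] Xpos by simp
      also have "W i \<le> r i / (1 - lam)"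
        unfolding W_def r_def using par by (intro shifted_tail_0_le) auto
      finally have ri: "(1 - lam) * e < r i"
        using par by (simp add: pos_less_divide_eq mult.commute)
      then have "0 < r (Suc k)" using par e k by (smt (verit) mult_pos_pos)
      \<comment> \<open>A positive occupancy means that the cut-off at 0 is inactive; this also
        excludes \<open>p = 1\<close>, where the quotient is 0.\<close>
      then have pos: "0 < (x * r k - p) / (1 - p)"
        by (simp add: r_def)
      then have "p \<noteq> 1" by auto
      with \<open>0 < r (Suc k)\<close> have "(1 - p) * r (Suc k) = x * r k - p"
        using pos by (simp add: r_def)
      moreover have "r (Suc k) \<le> r k"
        unfolding r_def using par by (intro eq_occ_Suc_le) auto
      then have "c < (lam - x) * r k"
        unfolding c_def using ri par k by (intro mult_strict_left_mono) auto
      ultimately have "c < lam * r k - (1 - p) * r (Suc k) - p"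
        by (simp add: algebra_simps)
      then show "c < lam * (X s (i - 1) - X s i) - (1 - p) * (X s i - X s (i + 1)) - p"
        using diff[of k] diff[of "Suc k"] by (simp add: X_def k)
    qed (use par a T t_eq in auto)
    then show ?thesis using T by (simp add: X_def t_eq)
  qed
  then show ?thesis unfolding W_def by blast
qed

section \<open>Identification of the equilibrium and its continuity in \<open>lam\<close>\<close>

lemma is_vI_eq_shifted_tail:
  assumes w: "is_vI lam p w" and par: "0 \<le> lam" "lam < 1" "0 \<le> p" "p \<le> 1"
  shows "w i = shifted_tail lam p 0 i"
proof -
  have V: "w \<in> V_bar_inf"
    and eq: "lam * (w (i - 1) - w i) - (1 - p) * (w i - w (i + 1)) - g_fun lam p w i = 0"
    if "1 \<le> i" for i
    using w that by (auto simp: is_vI_def)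
  note V = V[OF order_refl]
  note D = V_bar_inf_D[OF V]
  have "w k - w (Suc k) = eq_occ lam p k" for k
  proof (induction k)
    case (Suc k)
    define s where "s = w k - w (Suc k)"
    define s' where "s' = w (Suc k) - w (Suc (Suc k))"
    have s': "0 \<le> s'" using D(3)[of "Suc k"] by (simp add: s'_def)
    have s: "0 \<le> s" "s \<le> 1"
      using eq_occ_bounds(1)[of lam 1 p k] eq_occ_nonneg[of lam p k] Suc par
      by (auto simp: s_def)
    have bal: "lam * s - (1 - p) * s' = g_fun lam p w (Suc k)"
      using eq[of "Suc k"] by (simp add: s_def s'_def)
    \<comment> \<open>For \<open>w (Suc k) > 0\<close> the balance equation is the recursion without
      cut-off. Otherwise \<open>s' = 0\<close>, and \<open>g_fun \<le> p\<close> yields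
      \<open>lam * s \<le> p\<close>, so the cut-off is active.\<close>
    have "s' = max 0 ((lam * s - p) / (1 - p))"
    proof (cases "0 < w (Suc k)")
      case True
      then have bal': "lam * s - p = (1 - p) * s'" using bal by (simp add: g_fun_def)
      have "p \<noteq> 1"
      proof
        assume "p = 1"
        then have "lam * s = 1" using bal' by simp
        moreover have "lam * s \<le> lam * 1" using par s by (intro mult_left_mono) auto
        ultimately show False using par by simp
      qed
      then show ?thesis using bal' s' by simp
    next
      case False
      then have w0: "w (Suc k) = 0" using D(2)[of "Suc k"] by simp
      then have s'0: "s' = 0" using s' D(2)[of "Suc (Suc k)"] by (simp add: s'_def)
      have "lam * s \<le> p"
      proof (cases "0 < w k")
        case True
        then have "lam * s = min (lam * w k) p"
          using bal s'0 w0 by (simp add: g_fun_def)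
        then show ?thesis by (metis min.cobounded2)
      next
        case False
        then have "s = 0" using s(1) w0 by (simp add: s_def)
        then show ?thesis using par by simp
      qed
      then have "(lam * s - p) / (1 - p) \<le> 0"
        using par by (intro divide_nonpos_nonneg) auto
      then show ?thesis using s'0 by simp
    qed
    then show ?case using Suc by (simp add: s_def s'_def)
  qed (use D(5) in simp)
  then show ?thesis using D(4)[of i] by (simp add: shifted_tail_def)
qed

lemma shifted_tail_0_continuous:
  assumes par: "0 \<le> lam" "lam < 1" "0 \<le> p" "p \<le> 1" and e: "0 < e"
  obtains d where "0 < d" "\<And>x i. \<lbrakk>x \<noteq> lam; \<bar>x - lam\<bar> < d\<rbrakk> \<Longrightarrow>
    \<bar>shifted_tail x p 0 i - shifted_tail lam p 0 i\<bar> \<le> e"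
proof -
  \<comment> \<open>For \<open>x < m\<close> both occupancies at \<open>k\<close> lie between 0 and
    \<open>m ^ k\<close>: a summable majorant independent of \<open>x\<close>, as Tannery's theorem
    needs.\<close>
  define m where "m = (1 + lam) / 2"
  have m: "0 \<le> m" "lam < m" "m < 1" using par by (auto simp: m_def)
  define a where "a k x = \<bar>eq_occ x p k - eq_occ lam p k\<bar>" for k x
  have "((\<lambda>x. eq_occ x p k) \<longlongrightarrow> eq_occ lam p k) (at lam)" for k
  proof (induction k)
    case (Suc k)
    \<comment> \<open>Multiplication by a constant covers \<open>p = 1\<close>, where the limit rule
      for quotients would fail.\<close>
    have "((\<lambda>x. max 0 ((x * eq_occ x p k - p) * inverse (1 - p)))
        \<longlongrightarrow> max 0 ((lam * eq_occ lam p k - p) * inverse (1 - p))) (at lam)"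
      by (intro tendsto_intros Suc)
    then show ?case by (simp add: divide_inverse)
  qed simp
  then have lim: "((\<lambda>x. a k x) \<longlongrightarrow> 0) (at lam)" for k
    unfolding a_def using tendsto_rabs_zero LIM_zero by blast
  have le: "norm (a k x) \<le> m ^ k" if "x < m" for k x
    using eq_occ_add_le[of x m p k 0] eq_occ_add_le[of lam m p k 0] that m par
      eq_occ_nonneg[of x p k] eq_occ_nonneg[of lam p k]
    by (simp add: a_def)
  have ev: "\<forall>\<^sub>F x in at lam. x < m"
    using m(2) by (intro order_tendstoD(2)[OF tendsto_ident_at])
  have bound: "\<forall>\<^sub>F (k, x) in at_top \<times>\<^sub>F at lam. norm (a k x) \<le> m ^ k"
    using eventually_prodI[OF always_eventually[of "\<lambda>_. True"] ev]
    by (rule eventually_mono) (auto intro: le[simplified])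
  have "((\<lambda>x. \<Sum>k. a k x) \<longlongrightarrow> (\<Sum>k. 0)) (at lam)"
    using tannerys_theorem[OF lim bound] m by (simp add: summable_geometric)
  then have "\<forall>\<^sub>F x in at lam. (\<Sum>k. a k x) < e"
    using e by (intro order_tendstoD(2)) auto
  with ev have "\<forall>\<^sub>F x in at lam. x < m \<and> (\<Sum>k. a k x) < e"
    by eventually_elim simp
  then obtain d where d: "0 < d" "\<And>x. x \<noteq> lam \<Longrightarrow> dist x lam < d \<Longrightarrow> x < m \<and> (\<Sum>k. a k x) < e"
    unfolding eventually_at by auto
  show thesis
  proof (rule that[OF d(1)])
    fix x i assume x: "x \<noteq> lam" "\<bar>x - lam\<bar> < d"
    then have xm: "x < m" and sum: "(\<Sum>k. a k x) < e"
      using d(2) by (auto simp: dist_real_def)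
    have a_summable: "summable (\<lambda>k. a k x)"
      by (rule summable_comparison_test'[of "\<lambda>k. m ^ k" 0])
         (use le[OF xm] m in \<open>auto intro: summable_geometric\<close>)
    have "\<bar>shifted_tail x p 0 i - shifted_tail lam p 0 i\<bar>
        = \<bar>\<Sum>j. eq_occ x p (j + i) - eq_occ lam p (j + i)\<bar>"
      using summable_eq_occ[of x p i 0] summable_eq_occ[of lam p i 0] xm m par
      by (simp add: shifted_tail_def suminf_diff)
    also have "\<dots> \<le> (\<Sum>j. a (j + i) x)"
      unfolding a_def using summable_ignore_initial_segment[OF a_summable, of i]
      by (intro summable_rabs) (simp add: a_def)
    \<comment> \<open>Restoring the first \<open>i\<close> nonnegative terms makes the bound uniform
      in \<open>i\<close>.\<close>
    also have "\<dots> \<le> (\<Sum>k. a k x)"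
      using suminf_split_initial_segment[OF a_summable, of i]
      by (simp add: a_def sum_nonneg)
    finally show "\<bar>shifted_tail x p 0 i - shifted_tail lam p 0 i\<bar> \<le> e"
      using sum by simp
  qed
qed

section \<open>From uniform convergence to the weighted norm\<close>

lemma wnorm_le:
  assumes "\<And>i. \<bar>x i\<bar> \<le> e"
  shows "0 \<le> wnorm x" "wnorm x \<le> sqrt 2 * e"
proof -
  have e: "0 \<le> e" using assms[of 0] by simp
  have sq: "(x i)\<^sup>2 \<le> e\<^sup>2" for i
    using assms[of i] by (metis abs_ge_zero power2_abs power_mono)
  have sg: "(\<lambda>i. (1 / 2 :: real) ^ i * e\<^sup>2) sums (2 * e\<^sup>2)"
    using sums_mult2[OF geometric_sums[of "1 / 2 :: real"], of "e\<^sup>2"] by simp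
  have sm: "summable (\<lambda>i. (1 / 2) ^ i * (x i)\<^sup>2)"
    by (rule summable_comparison_test'[OF sums_summable[OF sg], of 0])
       (use sq in \<open>auto intro!: mult_left_mono\<close>)
  show "0 \<le> wnorm x"
    unfolding wnorm_def by (intro real_sqrt_ge_zero suminf_nonneg sm) auto
  have "(\<Sum>i. (1 / 2) ^ i * (x i)\<^sup>2) \<le> 2 * e\<^sup>2"
    unfolding sums_unique[OF sg]
    using sq by (intro suminf_le sm sums_summable[OF sg] mult_left_mono) auto
  then have "wnorm x \<le> sqrt (2 * e\<^sup>2)"
    unfolding wnorm_def by (rule real_sqrt_le_mono)
  also have "\<dots> = sqrt 2 * e" using e by (simp add: real_sqrt_mult)
  finally show "wnorm x \<le> sqrt 2 * e" .
qed

theorem theorem3: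
  fixes lam p :: real and v0 vI :: "nat \<Rightarrow> real" and v :: "real \<Rightarrow> nat \<Rightarrow> real"
  assumes "0 \<le> lam" "lam < 1" "0 \<le> p" "p \<le> 1"
    and "v0 \<in> V_bar_inf"
    and "fluid_solution lam p v0 v"
    and "is_vI lam p vI"
  shows "((\<lambda>t. wnorm (\<lambda>i. v t i - vI i)) \<longlongrightarrow> 0) at_top"
proof (rule tendstoI)
  fix e :: real assume "0 < e"
  \<comment> \<open>The barrier and the change of parameter each cost \<open>d\<close>; the weights
    sum to 2, so the norm is at most \<open>2 * d * sqrt 2 < e\<close>.\<close>
  define d where "d = e / 4"
  have d: "0 < d" "2 * d * sqrt 2 < e"
    using \<open>0 < e\<close> sqrt2_less_2 by (auto simp: d_def)
  obtain b where b: "0 < b" "\<And>x i. \<lbrakk>x \<noteq> lam; \<bar>x - lam\<bar> < b\<rbrakk> \<Longrightarrow>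
      \<bar>shifted_tail x p 0 i - shifted_tail lam p 0 i\<bar> \<le> d"
    using shifted_tail_0_continuous[OF assms(1-4) d(1)] by blast
  \<comment> \<open>Small enough that \<open>lam + c\<close> and \<open>lam - c\<close> are within
    \<open>b\<close> of \<open>lam\<close> and \<open>lam + c < 1\<close>.\<close>
  define c where "c = min b (1 - lam) / 2"
  have c: "0 < c" "c < b" "lam + c < 1"
    using b(1) assms(2) by (auto simp: c_def min_def field_simps)
  obtain t1 where t1: "\<And>t i. t1 \<le> t \<Longrightarrow> v t i \<le> shifted_tail (lam + c) p 0 i + d"
    using fluid_solution_eventually_le[OF assms(6,1) _ c(3) assms(3,4) d(1)] c by auto
  obtain t2 where t2: "\<And>t i. t2 \<le> t \<Longrightarrow> shifted_tail (lam - c) p 0 i - d \<le> v t i"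
    using fluid_solution_eventually_ge[OF assms(6,1) _ assms(2-4) d(1), of "lam - c"] c by auto
  have "dist (wnorm (\<lambda>i. v t i - vI i)) 0 < e" if "max t1 t2 \<le> t" for t
  proof -
    have "\<bar>v t i - vI i\<bar> \<le> 2 * d" for i
      using t1[of t i] t2[of t i] that b(2)[of "lam + c" i] b(2)[of "lam - c" i] c
        is_vI_eq_shifted_tail[OF assms(7,1-4), of i]
      by (simp add: abs_le_iff)
    note wnorm_le[of "\<lambda>i. v t i - vI i", OF this]
    then show ?thesis using d(2) by (simp add: dist_real_def mult.commute)
  qed
  then show "\<forall>\<^sub>F t in at_top. dist (wnorm (\<lambda>i. v t i - vI i)) 0 < e"
    unfolding eventually_at_top_linorder by blast
qed

end
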